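(* Let $G$ and $H$ be non-trivial graphs, and let $S_G$ and $S_H$ be feasible total mutual-visibility sets of $G$ and $H$, respectively. Then there exists a feasible total mutual-visibility set $S$ of the strong product $G\boxtimes H$ such that $$|S| \ge |S_G|\, n(H) + |S_H|\, n(G) - |S_G|\cdot |S_H|.$$ In particular, if both $G$ and $H$ admit feasible $\mu_{\rm t}$-sets, then $$\mu_{\rm t}(G\boxtimes H) \ge \mu_{\rm t}(G)\, n(H) + \mu_{\rm t}(H)\, n(G) - \mu_{\rm t}(G)\,\mu_{\rm t}(H).$$
   Context: All graphs are finite, simple, undirected and connected; $n(G)$ is the number of vertices of $G$. A graph is non-trivial if it has at least two vertices. For $X\subseteq V(G)$, two vertices $x,y\in V(G)$ are $X$-visible if there is a shortest $x,y$-path in $G$ none of whose internal vertices lies in $X$. A set $X\subseteq V(G)$ is a total mutual-visibility set of $G$ if every pair of vertices of $G$ is $X$-visible. The total mutual-visibility number $\mu_{\rm t}(G)$ is the largest cardinality of a total mutual-visibility set of $G$ (it is $0$ if there is no nonempty such set); a $\mu_{\rm t}$-set of $G$ is a total mutual-visibility set of cardinality $\mu_{\rm t}(G)$. A total mutual-visibility set $S$ of $G$ is feasible if any two adjacent vertices $x,y\in S$ have a common neighbor $z\notin S$. The strong product $G\boxtimes H$ has vertex set $V(G)\times V(H)$, and $(g,h)$ and $(g',h')$ are adjacent iff either $gg'\in E(G)$ and $h=h'$, or $g=g'$ and $hh'\in E(H)$, or $gg'\in E(G)$ and $hh'\in E(H)$. *)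

theory Defs
  imports "Graph_Theory.Graph_Theory"
begin

text \<open>
  A finite simple undirected graph is a \<^locale>\<open>pair_graph\<close>: every edge is represented
  by both of its orientations. Paths are vertex lists, including both end vertices.
\<close>

definition shortest_path :: "'a pair_pre_digraph \<Rightarrow> 'a \<Rightarrow> 'a vwalk \<Rightarrow> 'a \<Rightarrow> bool" where
  "shortest_path G x p y \<longleftrightarrow>
     vpath p G \<and> hd p = x \<and> last p = y \<and>
     (\<forall>q. vpath q G \<and> hd q = x \<and> last q = y \<longrightarrow> vwalk_length p \<le> vwalk_length q)"

definition internal_verts :: "'a vwalk \<Rightarrow> 'a set" where
  "internal_verts p = set (butlast (tl p))"

definition visible :: "'a pair_pre_digraph \<Rightarrow> 'a set \<Rightarrow> 'a \<Rightarrow> 'a \<Rightarrow> bool" where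
  "visible G X x y \<longleftrightarrow> (\<exists>p. shortest_path G x p y \<and> internal_verts p \<inter> X = {})"

definition total_mutual_visibility_set :: "'a pair_pre_digraph \<Rightarrow> 'a set \<Rightarrow> bool" where
  "total_mutual_visibility_set G X \<longleftrightarrow>
     X \<subseteq> pverts G \<and> (\<forall>x \<in> pverts G. \<forall>y \<in> pverts G. visible G X x y)"

text \<open>
  For a connected graph the empty set is a total mutual-visibility set, so the maximum below
  is taken over a nonempty finite set, and it is 0 if no nonempty such set exists.
\<close>

definition mu_t :: "'a pair_pre_digraph \<Rightarrow> nat" where
  "mu_t G = Max {card X | X. total_mutual_visibility_set G X}"

definition mu_t_set :: "'a pair_pre_digraph \<Rightarrow> 'a set \<Rightarrow> bool" where
  "mu_t_set G X \<longleftrightarrow> total_mutual_visibility_set G X \<and> card X = mu_t G"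

definition feasible :: "'a pair_pre_digraph \<Rightarrow> 'a set \<Rightarrow> bool" where
  "feasible G S \<longleftrightarrow> total_mutual_visibility_set G S \<and>
     (\<forall>x \<in> S. \<forall>y \<in> S. (x, y) \<in> parcs G \<longrightarrow>
        (\<exists>z. z \<notin> S \<and> (x, z) \<in> parcs G \<and> (y, z) \<in> parcs G))"

definition strong_product ::
  "'a pair_pre_digraph \<Rightarrow> 'b pair_pre_digraph \<Rightarrow> ('a \<times> 'b) pair_pre_digraph"
  (infixl \<open>\<boxtimes>\<close> 70) where
  "G \<boxtimes> H = \<lparr> pverts = pverts G \<times> pverts H,
     parcs = {((g, h), (g', h')) | g h g' h'.
       (g, g') \<in> parcs G \<and> h = h' \<and> h \<in> pverts H \<or>
       g = g' \<and> g \<in> pverts G \<and> (h, h') \<in> parcs H \<or>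
       (g, g') \<in> parcs G \<and> (h, h') \<in> parcs H} \<rparr>"

lemma pair_graph_strong_product:
  assumes "pair_graph G" "pair_graph H"
  shows "pair_graph (G \<boxtimes> H)"
proof -
  interpret G: pair_graph G by fact
  interpret H: pair_graph H by fact
  have sub: "parcs (G \<boxtimes> H) \<subseteq> pverts (G \<boxtimes> H) \<times> pverts (G \<boxtimes> H)"
    by (auto simp: strong_product_def dest: G.wellformed' H.wellformed')
  have fin: "finite (pverts (G \<boxtimes> H))"
    by (simp add: strong_product_def G.pair_finite_verts H.pair_finite_verts)
  have fin_arcs: "finite (parcs (G \<boxtimes> H))"
    using finite_subset[OF sub] fin by simp
  have sym: "sym (parcs (G \<boxtimes> H))"
    using G.pair_sym_arcs H.pair_sym_arcs
    by (auto simp: strong_product_def symmetric_def sym_def)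
  have irrefl: "fst e \<noteq> snd e" if "e \<in> parcs (G \<boxtimes> H)" for e
    using that G.pair_no_loops H.pair_no_loops by (fastforce simp: strong_product_def)
  show ?thesis
    using sub fin fin_arcs sym irrefl
    by unfold_locales (auto simp: symmetric_def)
qed

lemma connected_strong_product:
  assumes "pair_graph G" "pair_graph H" "connected G" "connected H"
  shows "connected (G \<boxtimes> H)"
proof -
  interpret G: pair_graph G by fact
  interpret H: pair_graph H by fact
  interpret P: pair_graph "G \<boxtimes> H" using assms by (intro pair_graph_strong_product)
  have sG: "strongly_connected G"
    using G.symmetric_connected_imp_strongly_connected G.pair_sym_arcs assms by blast
  have sH: "strongly_connected H"
    using H.symmetric_connected_imp_strongly_connected H.pair_sym_arcs assms by blast
  have a: "(g, h) \<rightarrow>\<^sup>*\<^bsub>with_proj (G \<boxtimes> H)\<^esub> (g', h)" if "g \<rightarrow>\<^sup>*\<^bsub>with_proj G\<^esub> g'" "h \<in> pverts H" for g g' h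
    using that(1)
  proof (induction rule: G.reachable_induct)
    case base
    then show ?case using that by (intro P.reachable_refl) (simp add: strong_product_def)
  next
    case (step x y)
    then have "((x, h), (y, h)) \<in> parcs (G \<boxtimes> H)" using that by (simp add: strong_product_def)
    with step show ?case using P.reachable_adj_trans by (metis with_proj_simps(3))
  qed
  have b: "(g, h) \<rightarrow>\<^sup>*\<^bsub>with_proj (G \<boxtimes> H)\<^esub> (g, h')" if "h \<rightarrow>\<^sup>*\<^bsub>with_proj H\<^esub> h'" "g \<in> pverts G" for g h h'
    using that(1)
  proof (induction rule: H.reachable_induct)
    case base
    then show ?case using that by (intro P.reachable_refl) (simp add: strong_product_def)
  next
    case (step x y)
    then have "((g, x), (g, y)) \<in> parcs (G \<boxtimes> H)" using that by (simp add: strong_product_def)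
    with step show ?case using P.reachable_adj_trans by (metis with_proj_simps(3))
  qed
  have "strongly_connected (G \<boxtimes> H)"
  proof (rule strongly_connectedI)
    show "verts (G \<boxtimes> H) \<noteq> {}"
      using sG sH by (auto simp: strongly_connected_def strong_product_def)
  next
    fix u v assume "u \<in> verts (G \<boxtimes> H)" "v \<in> verts (G \<boxtimes> H)"
    then obtain g h g' h' where *: "u = (g, h)" "v = (g', h')"
      "g \<in> pverts G" "h \<in> pverts H" "g' \<in> pverts G" "h' \<in> pverts H"
      by (auto simp: strong_product_def)
    have "(g, h) \<rightarrow>\<^sup>*\<^bsub>with_proj (G \<boxtimes> H)\<^esub> (g', h)"
      using a sG * by (auto simp: strongly_connected_def)
    moreover have "(g', h) \<rightarrow>\<^sup>*\<^bsub>with_proj (G \<boxtimes> H)\<^esub> (g', h')"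
      using b sH * by (auto simp: strongly_connected_def)
    ultimately show "u \<rightarrow>\<^sup>*\<^bsub>with_proj (G \<boxtimes> H)\<^esub> v"
      using * P.reachable_trans by blast
  qed
  moreover have "(parcs (G \<boxtimes> H))\<^sup>s = parcs (G \<boxtimes> H)"
    using P.pair_sym_arcs by (auto simp: symmetric_def symcl_def sym_def)
  ultimately show ?thesis
    by (simp add: connected_conv strongly_connected_def reachable_def)
qed

lemma ex_shortest_path:
  assumes "pair_graph G" "connected G" "x \<in> pverts G" "y \<in> pverts G"
  shows "\<exists>p. shortest_path G x p y"
proof -
  interpret G: pair_graph G by fact
  have "x \<rightarrow>\<^sup>*\<^bsub>with_proj G\<^esub> y"
    using G.symmetric_connected_imp_strongly_connected G.pair_sym_arcs assms
    by (auto simp: strongly_connected_def)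
  then obtain p where "vpath p G \<and> hd p = x \<and> last p = y"
    using G.reachable_vpath_conv by blast
  from ex_has_least_nat[of "\<lambda>p. vpath p G \<and> hd p = x \<and> last p = y", OF this, of vwalk_length]
  show ?thesis by (auto simp: shortest_path_def)
qed

lemma total_mutual_visibility_set_empty:
  assumes "pair_graph G" "connected G"
  shows "total_mutual_visibility_set G {}"
  using ex_shortest_path[OF assms] by (auto simp: total_mutual_visibility_set_def visible_def)

lemma finite_total_mutual_visibility_sets:
  assumes "pair_graph G"
  shows "finite {card X | X. total_mutual_visibility_set G X}"
proof -
  interpret G: pair_graph G by fact
  have "{X. total_mutual_visibility_set G X} \<subseteq> Pow (pverts G)"
    by (auto simp: total_mutual_visibility_set_def)
  then have "finite {X. total_mutual_visibility_set G X}"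
    using G.pair_finite_verts finite_subset by blast
  then show ?thesis by simp
qed

end

theory Submission
  imports Defs
begin

text \<open>
  Visibility only depends on lazy walks, i.e. walks in the reflexive closure of the adjacency
  relation, and in a strong product this relation is the componentwise one. So a shortest lazy
  walk in the product is a pair of lazy walks of the same length, the larger of the two
  distances. Feasibility is what allows the shorter of two geodesics to be lengthened by waiting
  while its internal vertices stay outside the set. Hence
  \<open>S\<^sub>G \<times> V(H) \<union> V(G) \<times> S\<^sub>H\<close>, whose complement is the product of the two complements, is a
  feasible total mutual-visibility set.
\<close>

section \<open>Lazy walks and index forms of paths\<close>

text \<open>Loops are placed at vertices only: with all of \<open>Id\<close>, an arc of one factor
  could be paired with a point outside the other factor, and
  \<open>closed_adj_strong_product\<close> would fail.\<close>

definition closed_adj :: "'a pair_pre_digraph \<Rightarrow> 'a rel" where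
  "closed_adj G = parcs G \<union> Id_on (pverts G)"

text \<open>What is kept out of \<open>X\<close> are positions, not vertices different from the
  ends. So waiting at an end that lies in \<open>X\<close> is forbidden, and a walk cannot always be
  lengthened for free.\<close>

definition avoiding_walk :: "'a rel \<Rightarrow> 'a set \<Rightarrow> 'a \<Rightarrow> 'a \<Rightarrow> nat \<Rightarrow> (nat \<Rightarrow> 'a) \<Rightarrow> bool" where
  "avoiding_walk R X x y n f \<longleftrightarrow> f 0 = x \<and> f n = y \<and>
     (\<forall>i<n. (f i, f (Suc i)) \<in> R) \<and> (\<forall>i. 0 < i \<and> i < n \<longrightarrow> f i \<notin> X)"

lemma avoiding_walk_imp_relpow: "avoiding_walk R X x y n f \<Longrightarrow> (x, y) \<in> R ^^ n"
  unfolding avoiding_walk_def relpow_fun_conv by blast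

lemma set_vwalk_arcs_conv_nth:
  "set (vwalk_arcs p) = {(p ! i, p ! Suc i) | i. Suc i < length p}"
proof (induction p rule: vwalk_arcs.induct)
  case (3 x y xs)
  show ?case (is "?L = ?R")
  proof -
    have "?L = insert (x, y) {((y # xs) ! i, (y # xs) ! Suc i) | i. Suc i < length (y # xs)}"
      using 3 by simp
    also have "\<dots> = ?R"
    proof (intro set_eqI iffI)
      fix e assume "e \<in> insert (x, y) {((y # xs) ! i, (y # xs) ! Suc i) | i. Suc i < length (y # xs)}"
      then consider "e = (x, y)"
        | i where "e = ((y # xs) ! i, (y # xs) ! Suc i)" "Suc i < length (y # xs)" by blast
      then show "e \<in> ?R"
      proof cases
        case 1
        then show ?thesis by force
      next
        case 2
        then have "e = ((x # y # xs) ! Suc i, (x # y # xs) ! Suc (Suc i))"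
          "Suc (Suc i) < length (x # y # xs)" by auto
        then show ?thesis by blast
      qed
    next
      fix e assume "e \<in> ?R"
      then obtain i where i: "e = ((x # y # xs) ! i, (x # y # xs) ! Suc i)"
        "Suc i < length (x # y # xs)" by blast
      then show "e \<in> insert (x, y) {((y # xs) ! i, (y # xs) ! Suc i) | i. Suc i < length (y # xs)}"
        by (cases i) auto
    qed
    finally show ?thesis .
  qed
qed auto

lemma internal_verts_conv_nth:
  "internal_verts p = {p ! i | i. 0 < i \<and> i < length p - 1}"
proof (cases p)
  case (Cons a q)
  have "set (butlast q) = {q ! i | i. i < length q - 1}"
    unfolding set_conv_nth by (force simp: nth_butlast)
  also have "\<dots> = {p ! i | i. 0 < i \<and> i < length p - 1}"
  proof (intro set_eqI iffI)
    fix v assume "v \<in> {q ! i | i. i < length q - 1}"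
    then obtain i where "v = p ! Suc i" "Suc i < length p - 1" using Cons by auto
    then show "v \<in> {p ! i | i. 0 < i \<and> i < length p - 1}" by blast
  next
    fix v assume "v \<in> {p ! i | i. 0 < i \<and> i < length p - 1}"
    then obtain i where i: "v = p ! i" "0 < i" "i < length p - 1" by blast
    then have "v = q ! (i - 1)" "i - 1 < length q - 1" using Cons by auto
    then show "v \<in> {q ! i | i. i < length q - 1}" by blast
  qed
  finally show ?thesis using Cons by (simp add: internal_verts_def)
qed (simp add: internal_verts_def)

section \<open>Visibility through shortest lazy walks\<close>

context pair_graph
begin

lemma closed_adj_in_verts: "(x, y) \<in> closed_adj G \<Longrightarrow> x \<in> pverts G \<and> y \<in> pverts G"
  by (auto simp: closed_adj_def dest: wellformed')

lemma closed_adj_refl: "x \<in> pverts G \<Longrightarrow> (x, x) \<in> closed_adj G"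
  by (simp add: closed_adj_def Id_on_def)

lemma closed_adj_sym: "(x, y) \<in> closed_adj G \<Longrightarrow> (y, x) \<in> closed_adj G"
  using pair_sym_arcs by (auto simp: closed_adj_def symmetric_def sym_def)

lemma vpath_imp_closed_adj_steps:
  assumes "vpath p G" "Suc i < length p"
  shows "(p ! i, p ! Suc i) \<in> closed_adj G"
  using assms by (force simp: vpath_def vwalk_def set_vwalk_arcs_conv_nth closed_adj_def)

text \<open>A repeated vertex would allow the section between its two occurrences to be cut out,
  leaving a shorter lazy walk. In particular no step is a loop, so every step is an arc.\<close>

lemma shortest_walk_imp_vpath:
  assumes x: "x \<in> pverts G"
    and f: "f 0 = x" "f n = y" "\<And>i. i < n \<Longrightarrow> (f i, f (Suc i)) \<in> closed_adj G"
    and min: "\<And>k. (x, y) \<in> closed_adj G ^^ k \<Longrightarrow> n \<le> k"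
  shows "vpath (map f [0..<Suc n]) G"
proof -
  have inj: "f i \<noteq> f j" if ij: "i < j" "j \<le> n" for i j
  proof
    assume eq: "f i = f j"
    have "(f 0, f i) \<in> closed_adj G ^^ i"
      using f ij by (auto simp: relpow_fun_conv)
    moreover have "(f j, f n) \<in> closed_adj G ^^ (n - j)"
      unfolding relpow_fun_conv using f ij
      by (intro exI[of _ "\<lambda>k. f (j + k)"]) auto
    ultimately have "(x, y) \<in> closed_adj G ^^ (i + (n - j))"
      using eq f by (auto simp: relpow_add)
    then show False using min ij by fastforce
  qed
  have "inj_on f {..<Suc n}"
    by (rule linorder_inj_onI) (use inj in auto)
  then have "distinct (map f [0..<Suc n])"
    by (simp add: distinct_map atLeast0LessThan del: upt_Suc)
  moreover have "set (map f [0..<Suc n]) \<subseteq> pverts G"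
  proof -
    have "f i \<in> pverts G" if "i \<le> n" for i
      using that x f closed_adj_in_verts by (cases i) (auto simp: Suc_le_eq)
    then show ?thesis by auto
  qed
  moreover have "(f i, f (Suc i)) \<in> parcs G" if "i < n" for i
    using f(3)[OF that] inj[of i "Suc i"] that by (auto simp: closed_adj_def)
  then have "set (vwalk_arcs (map f [0..<Suc n])) \<subseteq> parcs G"
    by (auto simp: set_vwalk_arcs_conv_nth simp del: upt_Suc)
  ultimately show ?thesis
    by (auto simp: vpath_def vwalk_def simp del: upt_Suc)
qed

text \<open>Paths are lazy walks, and shortest lazy walks are paths, so both notions have the same
  minimal length. The relational powers on the right are what can be projected from a product to its
  factors.\<close>

lemma visible_iff_avoiding_walk:
  assumes x: "x \<in> pverts G"
  shows "visible G X x y \<longleftrightarrow>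
    (\<exists>n f. avoiding_walk (closed_adj G) X x y n f \<and> (\<forall>k. (x, y) \<in> closed_adj G ^^ k \<longrightarrow> n \<le> k))"
proof
  assume "visible G X x y"
  then obtain p where p: "shortest_path G x p y" "internal_verts p \<inter> X = {}"
    by (auto simp: visible_def)
  then have vp: "vpath p G" and ends: "hd p = x" "last p = y" and ne: "p \<noteq> []"
    by (auto simp: shortest_path_def vpath_def vwalk_def)
  have walk: "avoiding_walk (closed_adj G) X x y (length p - 1) ((!) p)"
    using p(2) ends ne vpath_imp_closed_adj_steps[OF vp]
    by (auto simp: avoiding_walk_def internal_verts_conv_nth hd_conv_nth last_conv_nth)
  have "length p - 1 \<le> k" if k: "(x, y) \<in> closed_adj G ^^ k" for k
  proof -
    \<comment> \<open>Minimality of \<open>p\<close> is known only among paths. A lazy walk of least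
      length \<open>m\<close> is a path, so it can be compared with \<open>p\<close>.\<close>
    define m where "m = (LEAST k. (x, y) \<in> closed_adj G ^^ k)"
    have "(x, y) \<in> closed_adj G ^^ m" unfolding m_def using k by (rule LeastI)
    then obtain f where f: "f 0 = x" "f m = y" "\<And>i. i < m \<Longrightarrow> (f i, f (Suc i)) \<in> closed_adj G"
      by (auto simp: relpow_fun_conv)
    have "vpath (map f [0..<Suc m]) G"
      by (rule shortest_walk_imp_vpath[OF x f]) (auto simp: m_def Least_le)
    moreover have "hd (map f [0..<Suc m]) = x" "last (map f [0..<Suc m]) = y"
      using f by (auto simp: hd_map last_map simp del: upt_Suc)
    ultimately have "vwalk_length p \<le> vwalk_length (map f [0..<Suc m])"
      using p(1) unfolding shortest_path_def by blast
    also have "\<dots> = m" by simp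
    finally show ?thesis using Least_le[of "\<lambda>k. (x, y) \<in> closed_adj G ^^ k", OF k]
      by (simp add: m_def)
  qed
  with walk show "\<exists>n f. avoiding_walk (closed_adj G) X x y n f \<and>
      (\<forall>k. (x, y) \<in> closed_adj G ^^ k \<longrightarrow> n \<le> k)" by blast
next
  assume "\<exists>n f. avoiding_walk (closed_adj G) X x y n f \<and>
      (\<forall>k. (x, y) \<in> closed_adj G ^^ k \<longrightarrow> n \<le> k)"
  then obtain n f where f: "avoiding_walk (closed_adj G) X x y n f"
    and min: "\<And>k. (x, y) \<in> closed_adj G ^^ k \<Longrightarrow> n \<le> k" by blast
  let ?p = "map f [0..<Suc n]"
  have "vpath ?p G"
    using f min by (intro shortest_walk_imp_vpath[OF x]) (auto simp: avoiding_walk_def)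
  moreover have "hd ?p = x" "last ?p = y"
    using f by (auto simp: avoiding_walk_def hd_map last_map simp del: upt_Suc)
  moreover have "vwalk_length ?p \<le> vwalk_length q"
    if q: "vpath q G" "hd q = x" "last q = y" for q
  proof -
    have "q \<noteq> []" using q by (auto simp: vpath_def vwalk_def)
    then have "(x, y) \<in> closed_adj G ^^ (length q - 1)"
      unfolding relpow_fun_conv using q vpath_imp_closed_adj_steps[OF q(1)]
      by (intro exI[of _ "(!) q"]) (auto simp: hd_conv_nth last_conv_nth)
    then show ?thesis using min by simp
  qed
  moreover have "internal_verts ?p \<inter> X = {}"
    using f by (auto simp: avoiding_walk_def internal_verts_conv_nth simp del: upt_Suc)
  ultimately show "visible G X x y"
    unfolding visible_def shortest_path_def by blast
qed

section \<open>Lengthening walks by feasibility\<close>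

text \<open>This carries feasibility over to closed adjacency. An end outside \<open>S\<close>
  serves as \<open>z\<close> itself; two distinct ends in \<open>S\<close> are the case of the
  definition; for \<open>x = y\<close> in \<open>S\<close> a proper neighbour outside
  \<open>S\<close> has to be found.\<close>

lemma feasible_common_neighbour:
  assumes S: "feasible G S" and "2 \<le> card (pverts G)" and xy: "(x, y) \<in> closed_adj G"
  obtains z where "z \<notin> S" "(x, z) \<in> closed_adj G" "(z, y) \<in> closed_adj G"
proof -
  have V: "x \<in> pverts G" "y \<in> pverts G" using closed_adj_in_verts xy by auto
  note found = that
  have outside: thesis if x: "x = y" "x \<in> S"
  proof -
    \<comment> \<open>Visibility of \<open>x\<close> and a second vertex \<open>w\<close> supplies
      the connectedness that gives \<open>x\<close> a neighbour.\<close>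
    have "pverts G \<noteq> {x}" using assms(2) by auto
    then obtain w where w: "w \<in> pverts G" "w \<noteq> x" using V by blast
    then have "visible G S x w"
      using S V by (auto simp: feasible_def total_mutual_visibility_set_def)
    then obtain n f where "avoiding_walk (closed_adj G) S x w n f"
      using visible_iff_avoiding_walk V by blast
    then have "(x, w) \<in> (closed_adj G)\<^sup>*"
      by (blast intro: avoiding_walk_imp_relpow relpow_imp_rtrancl)
    moreover have "(closed_adj G)\<^sup>* \<subseteq> (parcs G)\<^sup>*"
      by (rule rtrancl_subset_rtrancl) (auto simp: closed_adj_def)
    ultimately have "(x, w) \<in> (parcs G)\<^sup>*" by blast
    then obtain u where u: "(x, u) \<in> parcs G"
      using w by (metis converse_rtranclE)
    \<comment> \<open>If the neighbour \<open>u\<close> is itself in \<open>S\<close>, feasibility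
      applied to the edge \<open>xu\<close> yields \<open>z\<close>; otherwise \<open>u\<close> will
      do.\<close>
    have "\<exists>z. z \<notin> S \<and> (x, z) \<in> parcs G"
      using u x S by (cases "u \<in> S") (auto simp: feasible_def)
    then obtain z where "z \<notin> S" "(x, z) \<in> closed_adj G" by (auto simp: closed_adj_def)
    then show thesis using found[of z] closed_adj_sym[of x z] x(1) by simp
  qed
  consider "x \<notin> S" | "y \<notin> S" | "x = y" "x \<in> S" | "x \<in> S" "y \<in> S" "(x, y) \<in> parcs G"
    using xy by (auto simp: closed_adj_def)
  then show thesis
  proof cases
    case 4
    then obtain z where "z \<notin> S" "(x, z) \<in> parcs G" "(y, z) \<in> parcs G"
      using S by (auto simp: feasible_def)
    then show thesis using found[of z] closed_adj_sym[of y z] by (simp add: closed_adj_def)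
  qed (use found outside xy V closed_adj_refl in blast)+
qed

text \<open>A walk with an internal vertex can wait there, and the trivial walk can take a loop,
  since a walk of length 1 has no internal position. Only a single step needs feasibility: the
  detour through a common closed neighbour outside \<open>S\<close>.\<close>

lemma avoiding_walk_Suc:
  assumes "feasible G S" "2 \<le> card (pverts G)" "x \<in> pverts G"
    and f: "avoiding_walk (closed_adj G) S x y n f"
  shows "\<exists>f'. avoiding_walk (closed_adj G) S x y (Suc n) f'"
proof -
  consider "n = 0" | "n = 1" | "2 \<le> n" by linarith
  then show ?thesis
  proof cases
    case 1
    then show ?thesis
      using assms closed_adj_refl by (intro exI[of _ "\<lambda>_. x"]) (auto simp: avoiding_walk_def)
  next
    case 2
    then have "(x, y) \<in> closed_adj G" using f by (auto simp: avoiding_walk_def)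
    then obtain z where "z \<notin> S" "(x, z) \<in> closed_adj G" "(z, y) \<in> closed_adj G"
      using feasible_common_neighbour assms by blast
    then show ?thesis
      using 2 by (intro exI[of _ "\<lambda>i. if i = 0 then x else if i = 1 then z else y"])
        (auto simp: avoiding_walk_def)
  next
    case 3
    \<comment> \<open>wait for one step at the first internal vertex\<close>
    let ?f = "\<lambda>i. if i \<le> 1 then f i else f (i - 1)"
    have "(f 1, f 1) \<in> closed_adj G"
      using f 3 closed_adj_in_verts[of "f 0" "f 1"] closed_adj_refl
      by (auto simp: avoiding_walk_def)
    moreover have "(f (i - 1), f i) \<in> closed_adj G" if "0 < i" "i < Suc n" for i
      using f that by (cases i) (auto simp: avoiding_walk_def)
    ultimately have "avoiding_walk (closed_adj G) S x y (Suc n) ?f"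
      using f 3 by (auto simp: avoiding_walk_def le_Suc_eq)
    then show ?thesis by blast
  qed
qed

lemma avoiding_walk_extend:
  assumes "feasible G S" "2 \<le> card (pverts G)" "x \<in> pverts G"
    and "avoiding_walk (closed_adj G) S x y n f" and "n \<le> m"
  shows "\<exists>f'. avoiding_walk (closed_adj G) S x y m f'"
  using \<open>n \<le> m\<close>
proof (induction m rule: dec_induct)
  case base
  then show ?case using assms by blast
next
  case (step m)
  then show ?case using avoiding_walk_Suc[OF assms(1-3)] by blast
qed

end

section \<open>Walks and feasible sets in the strong product\<close>

text \<open>Each coordinate either stays or moves along an arc; of the four combinations, three are
  the arcs of the product and the fourth is its loops.\<close>

lemma closed_adj_strong_product:
  assumes "pair_graph G" "pair_graph H"
  shows "((g, h), (g', h')) \<in> closed_adj (G \<boxtimes> H) \<longleftrightarrow>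
    (g, g') \<in> closed_adj G \<and> (h, h') \<in> closed_adj H"
proof -
  interpret G: pair_graph G by fact
  interpret H: pair_graph H by fact
  show ?thesis
    by (auto simp: closed_adj_def strong_product_def Id_on_iff dest: G.wellformed' H.wellformed')
qed

text \<open>Projecting a lazy walk preserves its length, because a resting coordinate uses a loop.
  This bounds distances in the product from below by those in both factors.\<close>

lemma relpow_closed_adj_strong_product:
  assumes "pair_graph G" "pair_graph H"
    and "((g, h), (g', h')) \<in> closed_adj (G \<boxtimes> H) ^^ k"
  shows "(g, g') \<in> closed_adj G ^^ k" "(h, h') \<in> closed_adj H ^^ k"
proof -
  obtain f where f: "f 0 = (g, h)" "f k = (g', h')"
    "\<And>i. i < k \<Longrightarrow> (f i, f (Suc i)) \<in> closed_adj (G \<boxtimes> H)"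
    using assms(3) by (auto simp: relpow_fun_conv)
  have "(fst (f i), fst (f (Suc i))) \<in> closed_adj G \<and> (snd (f i), snd (f (Suc i))) \<in> closed_adj H"
    if "i < k" for i
    using f(3)[OF that] by (metis closed_adj_strong_product[OF assms(1,2)] prod.collapse)
  then show "(g, g') \<in> closed_adj G ^^ k" "(h, h') \<in> closed_adj H ^^ k"
    unfolding relpow_fun_conv using f(1,2)
    by (auto intro!: exI[of _ "\<lambda>i. fst (f i)"]) (auto intro!: exI[of _ "\<lambda>i. snd (f i)"])
qed

theorem feasible_strong_product:
  assumes G: "pair_graph G" "2 \<le> card (pverts G)" "feasible G S"
    and H: "pair_graph H" "2 \<le> card (pverts H)" "feasible H T"
  shows "feasible (G \<boxtimes> H) (S \<times> pverts H \<union> pverts G \<times> T)"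
proof -
  interpret G: pair_graph G by fact
  interpret H: pair_graph H by fact
  interpret P: pair_graph "G \<boxtimes> H" using G H by (intro pair_graph_strong_product)
  let ?X = "S \<times> pverts H \<union> pverts G \<times> T"
  note adj = closed_adj_strong_product[OF G(1) H(1)]
  have sub: "S \<subseteq> pverts G" "T \<subseteq> pverts H"
    using G H by (auto simp: feasible_def total_mutual_visibility_set_def)
  have verts: "pverts (G \<boxtimes> H) = pverts G \<times> pverts H" by (simp add: strong_product_def)
  have vis: "visible (G \<boxtimes> H) ?X (g, h) (g', h')"
    if V: "g \<in> pverts G" "h \<in> pverts H" "g' \<in> pverts G" "h' \<in> pverts H" for g h g' h'
  proof -
    have "visible G S g g'" "visible H T h h'"
      using G H V by (auto simp: feasible_def total_mutual_visibility_set_def)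
    then obtain a p b q where
      p: "avoiding_walk (closed_adj G) S g g' a p" "\<And>k. (g, g') \<in> closed_adj G ^^ k \<Longrightarrow> a \<le> k" and
      q: "avoiding_walk (closed_adj H) T h h' b q" "\<And>k. (h, h') \<in> closed_adj H ^^ k \<Longrightarrow> b \<le> k"
      by (auto simp: G.visible_iff_avoiding_walk H.visible_iff_avoiding_walk V)
    obtain p' where p': "avoiding_walk (closed_adj G) S g g' (max a b) p'"
      using G.avoiding_walk_extend[OF G(3,2) V(1) p(1), of "max a b"] by auto
    obtain q' where q': "avoiding_walk (closed_adj H) T h h' (max a b) q'"
      using H.avoiding_walk_extend[OF H(3,2) V(2) q(1), of "max a b"] by auto
    \<comment> \<open>At an internal position both coordinates avoid their sets at once, which is
      exactly what avoiding the union \<open>?X\<close> requires.\<close>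
    have "avoiding_walk (closed_adj (G \<boxtimes> H)) ?X (g, h) (g', h') (max a b) (\<lambda>i. (p' i, q' i))"
      using p' q' by (auto simp: avoiding_walk_def adj)
    moreover have "max a b \<le> k" if "((g, h), (g', h')) \<in> closed_adj (G \<boxtimes> H) ^^ k" for k
      using relpow_closed_adj_strong_product[OF G(1) H(1) that] p(2) q(2) by simp
    ultimately show ?thesis
      using V by (subst P.visible_iff_avoiding_walk) (auto simp: verts)
  qed
  have nb: "\<exists>z. z \<notin> ?X \<and> (u, z) \<in> parcs (G \<boxtimes> H) \<and> (v, z) \<in> parcs (G \<boxtimes> H)"
    if uv: "u \<in> ?X" "v \<in> ?X" "(u, v) \<in> parcs (G \<boxtimes> H)" for u v
  proof -
    obtain g h g' h' where [simp]: "u = (g, h)" "v = (g', h')" by fastforce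
    have "(u, v) \<in> closed_adj (G \<boxtimes> H)" using uv by (simp add: closed_adj_def)
    then have a: "(g, g') \<in> closed_adj G" "(h, h') \<in> closed_adj H" by (auto simp: adj)
    obtain c where c: "c \<notin> S" "(g, c) \<in> closed_adj G" "(c, g') \<in> closed_adj G"
      using G.feasible_common_neighbour[OF G(3,2) a(1)] by blast
    obtain d where d: "d \<notin> T" "(h, d) \<in> closed_adj H" "(d, h') \<in> closed_adj H"
      using H.feasible_common_neighbour[OF H(3,2) a(2)] by blast
    have z: "(c, d) \<notin> ?X" using c d by auto
    moreover have "(u, (c, d)) \<in> closed_adj (G \<boxtimes> H)" "(v, (c, d)) \<in> closed_adj (G \<boxtimes> H)"
      using c d G.closed_adj_sym H.closed_adj_sym by (auto simp: adj)
    \<comment> \<open>Since \<open>u\<close> and \<open>v\<close> lie in \<open>?X\<close> and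
      \<open>(c, d)\<close> does not, the closed adjacencies are not loops and hence are
      arcs.\<close>
    moreover have "u \<noteq> (c, d)" "v \<noteq> (c, d)" using z uv by metis+
    ultimately show ?thesis unfolding closed_adj_def by blast
  qed
  have "total_mutual_visibility_set (G \<boxtimes> H) ?X"
    using sub vis unfolding total_mutual_visibility_set_def verts by blast
  then show ?thesis
    using nb unfolding feasible_def by blast
qed

section \<open>Cardinalities and the two bounds\<close>

lemma card_cross:
  assumes "finite V" "finite W" "S \<subseteq> V" "T \<subseteq> W"
  shows "int (card (S \<times> W \<union> V \<times> T)) =
    int (card S) * int (card W) + int (card T) * int (card V) - int (card S) * int (card T)"
proof -
  have "finite S" "finite T" using assms finite_subset by auto
  then have "card (S \<times> W) + card (V \<times> T) = card (S \<times> W \<union> V \<times> T) + card (S \<times> W \<inter> V \<times> T)"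
    using assms by (intro card_Un_Int) auto
  moreover have "S \<times> W \<inter> V \<times> T = S \<times> T" using assms by auto
  \<comment> \<open>Inclusion-exclusion is kept free of subtraction over the naturals and moved to
    the integers afterwards.\<close>
  ultimately have "card S * card W + card V * card T = card (S \<times> W \<union> V \<times> T) + card S * card T"
    by (simp add: card_cartesian_product)
  then have "int (card S * card W + card V * card T) =
      int (card (S \<times> W \<union> V \<times> T) + card S * card T)" by (rule arg_cong)
  then show ?thesis by (simp add: algebra_simps)
qed

theorem theorem4p1:
  fixes G :: "'a pair_pre_digraph" and H :: "'b pair_pre_digraph"
  assumes "pair_graph G" and "connected G" and "card (pverts G) \<ge> 2"
    and "pair_graph H" and "connected H" and "card (pverts H) \<ge> 2"
  shows "(\<forall>S\<^sub>G S\<^sub>H. feasible G S\<^sub>G \<and> feasible H S\<^sub>H \<longrightarrow>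
            (\<exists>S. feasible (G \<boxtimes> H) S \<and>
                 int (card S) \<ge> int (card S\<^sub>G) * int (card (pverts H))
                   + int (card S\<^sub>H) * int (card (pverts G))
                   - int (card S\<^sub>G) * int (card S\<^sub>H))) \<and>
         ((\<exists>S\<^sub>G. mu_t_set G S\<^sub>G \<and> feasible G S\<^sub>G) \<and> (\<exists>S\<^sub>H. mu_t_set H S\<^sub>H \<and> feasible H S\<^sub>H) \<longrightarrow>
            int (mu_t (G \<boxtimes> H)) \<ge> int (mu_t G) * int (card (pverts H))
              + int (mu_t H) * int (card (pverts G))
              - int (mu_t G) * int (mu_t H))"
proof -
  interpret G: pair_graph G by fact
  interpret H: pair_graph H by fact
  have main: "\<exists>S. feasible (G \<boxtimes> H) S \<and>
      int (card S) = int (card S\<^sub>G) * int (card (pverts H)) + int (card S\<^sub>H) * int (card (pverts G))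
        - int (card S\<^sub>G) * int (card S\<^sub>H)"
    if S: "feasible G S\<^sub>G" "feasible H S\<^sub>H" for S\<^sub>G S\<^sub>H
  proof (intro exI conjI)
    show "feasible (G \<boxtimes> H) (S\<^sub>G \<times> pverts H \<union> pverts G \<times> S\<^sub>H)"
      using assms S by (intro feasible_strong_product)
    show "int (card (S\<^sub>G \<times> pverts H \<union> pverts G \<times> S\<^sub>H)) =
        int (card S\<^sub>G) * int (card (pverts H)) + int (card S\<^sub>H) * int (card (pverts G))
        - int (card S\<^sub>G) * int (card S\<^sub>H)"
      using S G.pair_finite_verts H.pair_finite_verts
      by (intro card_cross) (auto simp: feasible_def total_mutual_visibility_set_def)
  qed
  \<comment> \<open>Finiteness of the set of cardinalities makes \<open>Max\<close> an upper bound
    for its members.\<close>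
  have le: "card S \<le> mu_t (G \<boxtimes> H)" if "feasible (G \<boxtimes> H) S" for S
    unfolding mu_t_def
    using that finite_total_mutual_visibility_sets[OF pair_graph_strong_product] assms
    by (intro Max_ge) (auto simp: feasible_def)
  show ?thesis
  proof (intro conjI allI impI; (elim conjE exE)?)
    fix S\<^sub>G S\<^sub>H assume "feasible G S\<^sub>G" "feasible H S\<^sub>H"
    from main[OF this] show "\<exists>S. feasible (G \<boxtimes> H) S \<and>
        int (card S) \<ge> int (card S\<^sub>G) * int (card (pverts H))
          + int (card S\<^sub>H) * int (card (pverts G)) - int (card S\<^sub>G) * int (card S\<^sub>H)"
      by (metis order_refl)
  next
    fix S\<^sub>G S\<^sub>H
    assume mu: "mu_t_set G S\<^sub>G" "mu_t_set H S\<^sub>H" and S: "feasible G S\<^sub>G" "feasible H S\<^sub>H"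
    \<comment> \<open>For \<open>mu_t\<close>-sets the cardinalities in \<open>main\<close> are
      \<open>mu_t G\<close> and \<open>mu_t H\<close>, and \<open>le\<close> bounds the resulting
      set in the product.\<close>
    from main[OF S] le show "int (mu_t (G \<boxtimes> H)) \<ge> int (mu_t G) * int (card (pverts H))
        + int (mu_t H) * int (card (pverts G)) - int (mu_t G) * int (mu_t H)"
      using mu unfolding mu_t_set_def by (metis of_nat_le_iff)
  qed
qed

end
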